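(* Every XCCS process is r-congruent to a process in r-external form (i.e. of the form $P\backslash L$ with $P$ unrestricted), and every XCCS process with no occurrence of the $|$ operator is r-congruent to an unrestricted process.
   Context: Fix a countable set $\mathcal N$ of names; running actions are $a,\overline a$ ($a\in\mathcal N$) and $\tau$. XCCS processes: $P::=\mathbf 0\mid END\mid\alpha.P\mid P_1;P_2\mid P_1+P_2\mid P_1|P_2\mid P^*\mid P\backslash L$, $\alpha$ a running action, $L\subseteq\mathcal N$; $\overline L=\{\overline a:a\in L\}$. A process is unrestricted if $\backslash$ does not occur in it. $n(P)$ is the set of names occurring in $P$ in input or output actions. An alpha conversion replaces a restricted name, in the restriction set $L$ and in all its occurrences within the scope of the corresponding $\backslash L$, by a name not occurring in the process. A congruence is an equivalence relation on processes preserved by all XCCS operators. r-congruence $\equiv_r$ is the least relation such that: it is a congruence; it is closed under alpha conversion; $\mathbf0\backslash L\equiv_r\mathbf0$; $END\backslash L\equiv_r END$; if $\alpha\notin L\cup\overline L$, $(\alpha.P)\backslash L\equiv_r\alpha.(P\backslash L)$; if $\alpha\in L\cup\overline L$, $(\alpha.P)\backslash L\equiv_r\mathbf0$; $(P;Q)\backslash L\equiv_r(P\backslash L);(Q\backslash L)$; $(P+Q)\backslash L\equiv_r(P\backslash L)+(Q\backslash L)$; if $n(P)\cap(L\cup\overline L)=\emptyset$, $P|(Q\backslash L)\equiv_r(P|Q)\backslash L$; $(P^* )\backslash L\equiv_r(P\backslash L)^*$; $P\backslash L\backslash M\equiv_r P\backslash(L\cup M)$; if $n(P)\cap(L\cup\overline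 L)=\emptyset$, $P\backslash L\equiv_r P$.
   Formalization: The set of names is taken infinite, and r-congruence also includes the mirror law (P\L)|Q ≡ (P|Q)\L when n(Q) avoids L; with only the listed law, ((a.0|ā.0)\{a})|0 has no r-external form. *)

theory Defs
  imports "HOL-Library.Countable" "HOL-Library.Infinite_Typeclass"
begin

text \<open>Names are the elements of a type \<^typ>\<open>'n\<close>; \<open>Out a\<close> is the co-action
  written \<open>a\<close> with a bar.\<close>

datatype 'n action = In 'n | Out 'n | Tau

datatype 'n xccs =
    Zero
  | END
  | Prefix "'n action" "'n xccs"
  | Seq "'n xccs" "'n xccs"
  | Choice "'n xccs" "'n xccs"
  | Par "'n xccs" "'n xccs"
  | Star "'n xccs"
  | Restrict "'n xccs" "'n set"

text \<open>The set \<open>L\<close> together with its co-names, as a set of actions.\<close>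

definition acts_of :: "'n set \<Rightarrow> 'n action set" where
  "acts_of L = In ` L \<union> Out ` L"

primrec action_names :: "'n action \<Rightarrow> 'n set" where
  "action_names (In a) = {a}"
| "action_names (Out a) = {a}"
| "action_names Tau = {}"

text \<open>\<open>n(P)\<close>: all names occurring in actions of \<open>P\<close>, free or restricted; restriction sets
  themselves do not contribute.\<close>

primrec names :: "'n xccs \<Rightarrow> 'n set" where
  "names Zero = {}"
| "names END = {}"
| "names (Prefix \<alpha> P) = action_names \<alpha> \<union> names P"
| "names (Seq P Q) = names P \<union> names Q"
| "names (Choice P Q) = names P \<union> names Q"
| "names (Par P Q) = names P \<union> names Q"
| "names (Star P) = names P"
| "names (Restrict P L) = names P"

primrec unrestricted :: "'n xccs \<Rightarrow> bool" where
  "unrestricted Zero \<longleftrightarrow> True"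
| "unrestricted END \<longleftrightarrow> True"
| "unrestricted (Prefix \<alpha> P) \<longleftrightarrow> unrestricted P"
| "unrestricted (Seq P Q) \<longleftrightarrow> unrestricted P \<and> unrestricted Q"
| "unrestricted (Choice P Q) \<longleftrightarrow> unrestricted P \<and> unrestricted Q"
| "unrestricted (Par P Q) \<longleftrightarrow> unrestricted P \<and> unrestricted Q"
| "unrestricted (Star P) \<longleftrightarrow> unrestricted P"
| "unrestricted (Restrict P L) \<longleftrightarrow> False"

primrec par_free :: "'n xccs \<Rightarrow> bool" where
  "par_free Zero \<longleftrightarrow> True"
| "par_free END \<longleftrightarrow> True"
| "par_free (Prefix \<alpha> P) \<longleftrightarrow> par_free P"
| "par_free (Seq P Q) \<longleftrightarrow> par_free P \<and> par_free Q"
| "par_free (Choice P Q) \<longleftrightarrow> par_free P \<and> par_free Q"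
| "par_free (Par P Q) \<longleftrightarrow> False"
| "par_free (Star P) \<longleftrightarrow> par_free P"
| "par_free (Restrict P L) \<longleftrightarrow> par_free P"

definition r_external :: "'n xccs \<Rightarrow> bool" where
  "r_external R \<longleftrightarrow> (\<exists>P L. unrestricted P \<and> R = Restrict P L)"

text \<open>Names occurring anywhere in a process, restriction sets included. The new name of an alpha
  conversion has to avoid all of these: one occurring only in an inner restriction set would be
  captured there.\<close>

primrec occurring :: "'n xccs \<Rightarrow> 'n set" where
  "occurring Zero = {}"
| "occurring END = {}"
| "occurring (Prefix \<alpha> P) = action_names \<alpha> \<union> occurring P"
| "occurring (Seq P Q) = occurring P \<union> occurring Q"
| "occurring (Choice P Q) = occurring P \<union> occurring Q"
| "occurring (Par P Q) = occurring P \<union> occurring Q"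
| "occurring (Star P) = occurring P"
| "occurring (Restrict P L) = occurring P \<union> L"

primrec rename_action :: "'n \<Rightarrow> 'n \<Rightarrow> 'n action \<Rightarrow> 'n action" where
  "rename_action a b (In c) = In (if c = a then b else c)"
| "rename_action a b (Out c) = Out (if c = a then b else c)"
| "rename_action a b Tau = Tau"

text \<open>\<open>rename a b P\<close> replaces the free occurrences of \<open>a\<close> by \<open>b\<close>; occurrences under an inner
  restriction of \<open>a\<close> belong to that restriction and are left alone.\<close>

primrec rename :: "'n \<Rightarrow> 'n \<Rightarrow> 'n xccs \<Rightarrow> 'n xccs" where
  "rename a b Zero = Zero"
| "rename a b END = END"
| "rename a b (Prefix \<alpha> P) = Prefix (rename_action a b \<alpha>) (rename a b P)"
| "rename a b (Seq P Q) = Seq (rename a b P) (rename a b Q)"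
| "rename a b (Choice P Q) = Choice (rename a b P) (rename a b Q)"
| "rename a b (Par P Q) = Par (rename a b P) (rename a b Q)"
| "rename a b (Star P) = Star (rename a b P)"
| "rename a b (Restrict P L) = Restrict (if a \<in> L then P else rename a b P) L"

text \<open>Alpha conversion is stated at the root of a restricted process; the congruence rules
  propagate it to subprocesses.

  Scope extrusion over parallel composition is included on both sides. With
  \<open>par_restrict_right\<close> alone, and no commutativity of \<open>|\<close>, a restriction in the left component
  cannot in general be moved outwards: \<open>((a.0 | Out a.0) \ {a}) | 0\<close> would have no r-external
  form.\<close>

inductive rcong :: "'n xccs \<Rightarrow> 'n xccs \<Rightarrow> bool" (infix "\<equiv>\<^sub>r" 50) where
  refl: "P \<equiv>\<^sub>r P"
| sym: "P \<equiv>\<^sub>r Q \<Longrightarrow> Q \<equiv>\<^sub>r P"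
| trans: "P \<equiv>\<^sub>r Q \<Longrightarrow> Q \<equiv>\<^sub>r R \<Longrightarrow> P \<equiv>\<^sub>r R"
| cong_prefix: "P \<equiv>\<^sub>r P' \<Longrightarrow> Prefix \<alpha> P \<equiv>\<^sub>r Prefix \<alpha> P'"
| cong_seq: "P \<equiv>\<^sub>r P' \<Longrightarrow> Q \<equiv>\<^sub>r Q' \<Longrightarrow> Seq P Q \<equiv>\<^sub>r Seq P' Q'"
| cong_choice: "P \<equiv>\<^sub>r P' \<Longrightarrow> Q \<equiv>\<^sub>r Q' \<Longrightarrow> Choice P Q \<equiv>\<^sub>r Choice P' Q'"
| cong_par: "P \<equiv>\<^sub>r P' \<Longrightarrow> Q \<equiv>\<^sub>r Q' \<Longrightarrow> Par P Q \<equiv>\<^sub>r Par P' Q'"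
| cong_star: "P \<equiv>\<^sub>r P' \<Longrightarrow> Star P \<equiv>\<^sub>r Star P'"
| cong_restrict: "P \<equiv>\<^sub>r P' \<Longrightarrow> Restrict P L \<equiv>\<^sub>r Restrict P' L"
| alpha: "a \<in> L \<Longrightarrow> b \<notin> occurring (Restrict P L) \<Longrightarrow>
    Restrict P L \<equiv>\<^sub>r Restrict (rename a b P) (insert b (L - {a}))"
| zero_restrict: "Restrict Zero L \<equiv>\<^sub>r Zero"
| END_restrict: "Restrict END L \<equiv>\<^sub>r END"
| prefix_restrict_pass: "\<alpha> \<notin> acts_of L \<Longrightarrow>
    Restrict (Prefix \<alpha> P) L \<equiv>\<^sub>r Prefix \<alpha> (Restrict P L)"
| prefix_restrict_block: "\<alpha> \<in> acts_of L \<Longrightarrow> Restrict (Prefix \<alpha> P) L \<equiv>\<^sub>r Zero"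
| seq_restrict: "Restrict (Seq P Q) L \<equiv>\<^sub>r Seq (Restrict P L) (Restrict Q L)"
| choice_restrict: "Restrict (Choice P Q) L \<equiv>\<^sub>r Choice (Restrict P L) (Restrict Q L)"
| par_restrict_right: "names P \<inter> L = {} \<Longrightarrow>
    Par P (Restrict Q L) \<equiv>\<^sub>r Restrict (Par P Q) L"
| par_restrict_left: "names Q \<inter> L = {} \<Longrightarrow>
    Par (Restrict P L) Q \<equiv>\<^sub>r Restrict (Par P Q) L"
| star_restrict: "Restrict (Star P) L \<equiv>\<^sub>r Star (Restrict P L)"
| restrict_restrict: "Restrict (Restrict P L) M \<equiv>\<^sub>r Restrict P (L \<union> M)"
| restrict_vacuous: "names P \<inter> L = {} \<Longrightarrow> Restrict P L \<equiv>\<^sub>r P"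

end

theory Submission
  imports Defs
begin

text \<open>Restrictions are moved outwards by reading the distribution laws from right to left. The side
  conditions require the restricted names to be fresh for the rest of the process, which alpha
  conversion achieves. A restriction set may be infinite and leave no fresh name at all, but
  \<open>P \ L\<close> is r-congruent to \<open>P \ (L \<inter> n(P))\<close>, so finite sets suffice. Without \<open>|\<close>, restrictions can
  instead be pushed inwards until they vanish at \<open>0\<close>, \<open>END\<close> or a blocked prefix.\<close>

declare rcong.refl [simp, intro]
declare rcong.trans [trans]

section \<open>Names, renaming and adjustment of restriction sets\<close>

lemma finite_names [simp]: "finite (names P)"
proof (induction P)
  case (Prefix \<alpha> P)
  then show ?case by (cases \<alpha>) auto
qed auto

lemma occurring_unrestricted: "unrestricted P \<Longrightarrow> occurring P = names P"
  by (induction P) auto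

lemma unrestricted_rename [simp]: "unrestricted (rename a b P) = unrestricted P"
  by (induction P) auto

lemma names_rename_subset: "names (rename a b P) \<subseteq> insert b (names P)"
proof (induction P)
  case (Prefix \<alpha> P)
  then show ?case by (cases \<alpha>) auto
qed auto

lemma in_acts_of_iff: "\<alpha> \<in> acts_of L \<longleftrightarrow> action_names \<alpha> \<inter> L \<noteq> {}"
  by (cases \<alpha>) (auto simp: acts_of_def)

text \<open>A vacuous restriction is created inside and merged with the outer one. This brings two
  operands under a common restriction set.\<close>

lemma rcong_restrict_vacuous_Un:
  assumes "names P \<inter> M = {}"
  shows "Restrict P L \<equiv>\<^sub>r Restrict P (M \<union> L)"
proof -
  have "Restrict P L \<equiv>\<^sub>r Restrict (Restrict P M) L"
    by (intro rcong.cong_restrict rcong.sym[OF rcong.restrict_vacuous] assms)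
  also have "\<dots> \<equiv>\<^sub>r Restrict P (M \<union> L)"
    by (rule rcong.restrict_restrict)
  finally show ?thesis .
qed

lemma rcong_restrict_Int_names: "Restrict P L \<equiv>\<^sub>r Restrict P (L \<inter> names P)"
proof -
  have "Restrict P (L \<inter> names P) \<equiv>\<^sub>r Restrict P ((L - names P) \<union> (L \<inter> names P))"
    by (rule rcong_restrict_vacuous_Un) auto
  also have "(L - names P) \<union> (L \<inter> names P) = L"
    by auto
  finally show ?thesis by (rule rcong.sym)
qed

text \<open>The inclusions \<open>L - A \<subseteq> L'\<close> and \<open>names P' \<subseteq> names P \<union> L'\<close> keep track of where new names
  may come from, so that two restrictions can be made fresh for each other's bodies.\<close>

lemma rcong_restrict_avoid:
  fixes P :: "'n :: infinite xccs"
  assumes "unrestricted P" "finite L" "finite A"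
  shows "\<exists>P' L'. unrestricted P' \<and> finite L' \<and> L' \<inter> A = {} \<and> L - A \<subseteq> L' \<and>
    names P' \<subseteq> names P \<union> L' \<and> Restrict P L \<equiv>\<^sub>r Restrict P' L'"
  using assms(1,2)
\<comment> \<open>Each alpha conversion removes one clashing name, changing both \<open>P\<close>
  and \<open>L\<close>.\<close>
proof (induction "card (L \<inter> A)" arbitrary: P L)
  case 0
  then have "L \<inter> A = {}" using assms(3) by simp
  with 0 show ?case by (intro exI[of _ P] exI[of _ L]) auto
next
  case (Suc n)
  then have "L \<inter> A \<noteq> {}" by auto
  then obtain a where a: "a \<in> L" "a \<in> A" by auto
  \<comment> \<open>Avoiding \<open>A\<close> makes the count drop; avoiding \<open>L\<close> and
    \<open>names P\<close> is the side condition of \<open>alpha\<close>, as \<open>P\<close> is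
    unrestricted.\<close>
  have "finite (A \<union> L \<union> names P)"
    using Suc.prems assms(3) by simp
  from ex_new_if_finite[OF infinite_UNIV this] obtain b where b: "b \<notin> A \<union> L \<union> names P" ..
  let ?L = "insert b (L - {a})"
  have step: "Restrict P L \<equiv>\<^sub>r Restrict (rename a b P) ?L"
    using a b Suc.prems by (intro rcong.alpha) (auto simp: occurring_unrestricted)
  have "?L \<inter> A = L \<inter> A - {a}"
    using a b by auto
  then have card: "n = card (?L \<inter> A)"
    using Suc.hyps(2) Suc.prems a by (simp add: card_Diff_singleton_if)
  have "unrestricted (rename a b P)" "finite ?L"
    using Suc.prems by simp_all
  from Suc.hyps(1)[OF card this] obtain P' L' where
    IH: "unrestricted P'" "finite L'" "L' \<inter> A = {}" "?L - A \<subseteq> L'"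
      "names P' \<subseteq> names (rename a b P) \<union> L'" "Restrict (rename a b P) ?L \<equiv>\<^sub>r Restrict P' L'"
    by blast
  \<comment> \<open>The new name \<open>b\<close> lies in \<open>?L - A\<close>, hence in
    \<open>L'\<close>; the lost name \<open>a\<close> lies in \<open>A\<close>.\<close>
  have "L - A \<subseteq> L'" "names P' \<subseteq> names P \<union> L'"
    using IH(4,5) a b names_rename_subset[of a b P] by auto
  with IH(1-3) rcong.trans[OF step IH(6)] show ?case by blast
qed

section \<open>External forms, one operator at a time\<close>

definition has_external_form :: "'n xccs \<Rightarrow> bool" where
  "has_external_form P \<longleftrightarrow> (\<exists>Q L. unrestricted Q \<and> P \<equiv>\<^sub>r Restrict Q L)"

lemma has_external_formI: "P \<equiv>\<^sub>r Restrict Q L \<Longrightarrow> unrestricted Q \<Longrightarrow> has_external_form P"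
  by (auto simp: has_external_form_def)

text \<open>Cutting \<open>L\<close> down to \<open>names Q\<close> makes it finite, so that its
  clashes with \<open>A\<close> can be renamed away.\<close>

lemma external_form_avoiding:
  fixes P :: "'n :: infinite xccs"
  assumes "has_external_form P" "finite A"
  obtains Q L where "unrestricted Q" "finite L" "L \<inter> A = {}" "P \<equiv>\<^sub>r Restrict Q L"
proof -
  obtain Q L where Q: "unrestricted Q" "P \<equiv>\<^sub>r Restrict Q L"
    using assms(1) by (auto simp: has_external_form_def)
  have P: "P \<equiv>\<^sub>r Restrict Q (L \<inter> names Q)"
    using Q(2) rcong_restrict_Int_names by (rule rcong.trans)
  have "finite (L \<inter> names Q)" by simp
  from rcong_restrict_avoid[OF Q(1) this assms(2)] obtain Q' L' where
    "unrestricted Q'" "finite L'" "L' \<inter> A = {}" "Restrict Q (L \<inter> names Q) \<equiv>\<^sub>r Restrict Q' L'"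
    by blast
  with P show thesis by (intro that[of Q' L'] rcong.trans[OF P])
qed

text \<open>The order of choices avoids circularity: \<open>L\<close> is chosen away from
  \<open>names Q1\<close>, then \<open>M1\<close> is renamed away from \<open>names P'\<close> and
  \<open>L\<close>. Any name this adds to \<open>Q1\<close> lies in \<open>M\<close>, so it cannot
  clash with \<open>L\<close>.\<close>

lemma external_forms_disjoint:
  fixes P Q :: "'n :: infinite xccs"
  assumes "has_external_form P" "has_external_form Q"
  obtains P' L Q' M where "unrestricted P'" "unrestricted Q'"
    "P \<equiv>\<^sub>r Restrict P' L" "Q \<equiv>\<^sub>r Restrict Q' M" "names P' \<inter> M = {}" "names Q' \<inter> L = {}"
proof -
  \<comment> \<open>Nothing is avoided yet; only finiteness of \<open>M1\<close> is wanted.\<close>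
  obtain Q1 M1 where Q1: "unrestricted Q1" "finite M1" "Q \<equiv>\<^sub>r Restrict Q1 M1"
    using external_form_avoiding[OF assms(2) finite.emptyI] by metis
  obtain P' L where P': "unrestricted P'" "finite L" "L \<inter> names Q1 = {}" "P \<equiv>\<^sub>r Restrict P' L"
    using external_form_avoiding[OF assms(1) finite_names] by metis
  obtain Q' M where Q': "unrestricted Q'" "M \<inter> (names P' \<union> L) = {}" "names Q' \<subseteq> names Q1 \<union> M"
    "Restrict Q1 M1 \<equiv>\<^sub>r Restrict Q' M"
    using rcong_restrict_avoid[OF Q1(1,2), of "names P' \<union> L"] P'(2) by auto
  show thesis
    using P' Q' by (intro that[of P' Q' L M] rcong.trans[OF Q1(3) Q'(4)]) auto
qed

text \<open>Covers \<open>Seq\<close> and \<open>Choice\<close>, over which restriction distributes: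
  both operands receive the set \<open>M \<union> L\<close>, which is then factored out.
  \<open>Par\<close> is treated separately by scope extrusion.\<close>

lemma has_external_form_binary:
  fixes P Q :: "'n :: infinite xccs"
  assumes "has_external_form P" "has_external_form Q"
    and cong: "\<And>P P' Q Q'. P \<equiv>\<^sub>r P' \<Longrightarrow> Q \<equiv>\<^sub>r Q' \<Longrightarrow> C P Q \<equiv>\<^sub>r C P' Q'"
    and distrib: "\<And>P Q L. Restrict (C P Q) L \<equiv>\<^sub>r C (Restrict P L) (Restrict Q L)"
    and unres: "\<And>P Q. unrestricted P \<Longrightarrow> unrestricted Q \<Longrightarrow> unrestricted (C P Q)"
  shows "has_external_form (C P Q)"
proof -
  obtain P' L Q' M where *: "unrestricted P'" "unrestricted Q'"
    "P \<equiv>\<^sub>r Restrict P' L" "Q \<equiv>\<^sub>r Restrict Q' M" "names P' \<inter> M = {}" "names Q' \<inter> L = {}"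
    by (rule external_forms_disjoint[OF assms(1,2)])
  have "P \<equiv>\<^sub>r Restrict P' (M \<union> L)"
    using *(3) rcong_restrict_vacuous_Un[OF *(5)] by (rule rcong.trans)
  moreover have "Q \<equiv>\<^sub>r Restrict Q' (M \<union> L)"
    using rcong.trans[OF *(4) rcong_restrict_vacuous_Un[OF *(6)]] by (simp add: Un_commute)
  ultimately have "C P Q \<equiv>\<^sub>r C (Restrict P' (M \<union> L)) (Restrict Q' (M \<union> L))"
    by (rule cong)
  also have "\<dots> \<equiv>\<^sub>r Restrict (C P' Q') (M \<union> L)"
    by (rule rcong.sym[OF distrib])
  finally show ?thesis
    using unres[OF *(1,2)] by (rule has_external_formI)
qed

lemma has_external_form_Par:
  fixes P Q :: "'n :: infinite xccs"
  assumes "has_external_form P" "has_external_form Q"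
  shows "has_external_form (Par P Q)"
proof -
  obtain P' L Q' M where *: "unrestricted P'" "unrestricted Q'"
    "P \<equiv>\<^sub>r Restrict P' L" "Q \<equiv>\<^sub>r Restrict Q' M" "names P' \<inter> M = {}" "names Q' \<inter> L = {}"
    by (rule external_forms_disjoint[OF assms])
  have "Par P Q \<equiv>\<^sub>r Par (Restrict P' L) (Restrict Q' M)"
    using *(3,4) by (rule rcong.cong_par)
  also have "\<dots> \<equiv>\<^sub>r Restrict (Par P' (Restrict Q' M)) L"
    \<comment> \<open>\<open>names\<close> ignores restriction sets, so the side condition for
      \<open>Restrict Q' M\<close> is one on \<open>names Q'\<close>.\<close>
    using *(6) by (intro rcong.par_restrict_left) simp
  also have "\<dots> \<equiv>\<^sub>r Restrict (Restrict (Par P' Q') M) L"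
    using *(5) by (intro rcong.cong_restrict rcong.par_restrict_right)
  also have "\<dots> \<equiv>\<^sub>r Restrict (Par P' Q') (M \<union> L)"
    by (rule rcong.restrict_restrict)
  finally show ?thesis
    by (rule has_external_formI) (simp add: *(1,2))
qed

text \<open>Once \<open>L\<close> avoids the name of \<alpha>, the passing law can be read from
  right to left.\<close>

lemma has_external_form_Prefix:
  fixes P :: "'n :: infinite xccs"
  assumes "has_external_form P"
  shows "has_external_form (Prefix \<alpha> P)"
proof -
  have "finite (action_names \<alpha>)" by (cases \<alpha>) auto
  from external_form_avoiding[OF assms this] obtain Q L where
    *: "unrestricted Q" "L \<inter> action_names \<alpha> = {}" "P \<equiv>\<^sub>r Restrict Q L"
    by metis
  have "Prefix \<alpha> P \<equiv>\<^sub>r Prefix \<alpha> (Restrict Q L)"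
    using *(3) by (rule rcong.cong_prefix)
  also have "\<dots> \<equiv>\<^sub>r Restrict (Prefix \<alpha> Q) L"
    using *(2) by (intro rcong.sym[OF rcong.prefix_restrict_pass]) (auto simp: in_acts_of_iff)
  finally show ?thesis
    by (rule has_external_formI) (simp add: *(1))
qed

lemma has_external_form: "has_external_form (P :: 'n :: infinite xccs)"
proof (induction P)
  case Zero
  show ?case
    by (rule has_external_formI[OF rcong.sym[OF rcong.zero_restrict]]) simp
next
  case END
  show ?case
    by (rule has_external_formI[OF rcong.sym[OF rcong.END_restrict]]) simp
next
  case (Prefix \<alpha> P)
  then show ?case by (rule has_external_form_Prefix)
next
  case (Seq P Q)
  then show ?case
    by (rule has_external_form_binary) (auto intro: rcong.cong_seq rcong.seq_restrict)
next
  case (Choice P Q)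
  then show ?case
    by (rule has_external_form_binary) (auto intro: rcong.cong_choice rcong.choice_restrict)
next
  case (Par P Q)
  then show ?case by (rule has_external_form_Par)
next
  case (Star P)
  then obtain Q L where "unrestricted Q" "P \<equiv>\<^sub>r Restrict Q L"
    by (auto simp: has_external_form_def)
  then show ?case
    by (intro has_external_formI[of _ "Star Q" L])
      (auto intro: rcong.trans[OF rcong.cong_star rcong.sym[OF rcong.star_restrict]])
next
  case (Restrict P M)
  then obtain Q L where "unrestricted Q" "P \<equiv>\<^sub>r Restrict Q L"
    by (auto simp: has_external_form_def)
  then show ?case
    by (intro has_external_formI[of _ Q "L \<union> M"])
      (auto intro: rcong.trans[OF rcong.cong_restrict rcong.restrict_restrict])
qed

section \<open>Eliminating restrictions in the absence of parallel composition\<close>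

lemma par_free_restrict_elim:
  assumes "unrestricted P" "par_free P"
  shows "\<exists>Q. unrestricted Q \<and> par_free Q \<and> Restrict P L \<equiv>\<^sub>r Q"
  using assms
proof (induction P)
  case Zero
  show ?case
    using rcong.zero_restrict by (intro exI[of _ Zero]) auto
next
  case END
  show ?case
    using rcong.END_restrict by (intro exI[of _ END]) auto
next
  case (Prefix \<alpha> P)
  show ?case
  proof (cases "\<alpha> \<in> acts_of L")
    case True
    then show ?thesis
      \<comment> \<open>A blocked prefix discards its continuation, so the induction hypothesis
        plays no part.\<close>
      using rcong.prefix_restrict_block by (intro exI[of _ Zero]) auto
  next
    case False
    from Prefix obtain Q where "unrestricted Q" "par_free Q" "Restrict P L \<equiv>\<^sub>r Q" by auto
    then show ?thesis
      using rcong.trans[OF rcong.prefix_restrict_pass[OF False] rcong.cong_prefix]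
      by (intro exI[of _ "Prefix \<alpha> Q"]) auto
  qed
next
  case (Seq P1 P2)
  then obtain Q1 Q2 where "unrestricted Q1" "par_free Q1" "Restrict P1 L \<equiv>\<^sub>r Q1"
    "unrestricted Q2" "par_free Q2" "Restrict P2 L \<equiv>\<^sub>r Q2" by auto
  then show ?case
    using rcong.trans[OF rcong.seq_restrict rcong.cong_seq] by (intro exI[of _ "Seq Q1 Q2"]) auto
next
  case (Choice P1 P2)
  then obtain Q1 Q2 where "unrestricted Q1" "par_free Q1" "Restrict P1 L \<equiv>\<^sub>r Q1"
    "unrestricted Q2" "par_free Q2" "Restrict P2 L \<equiv>\<^sub>r Q2" by auto
  then show ?case
    using rcong.trans[OF rcong.choice_restrict rcong.cong_choice]
    by (intro exI[of _ "Choice Q1 Q2"]) auto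
next
  case (Star P)
  then obtain Q where "unrestricted Q" "par_free Q" "Restrict P L \<equiv>\<^sub>r Q" by auto
  then show ?case
    using rcong.trans[OF rcong.star_restrict rcong.cong_star] by (intro exI[of _ "Star Q"]) auto
\<comment> \<open>\<open>Par\<close> contradicts \<open>par_free\<close>, and
  \<open>Restrict\<close> contradicts \<open>unrestricted\<close>.\<close>
qed auto

text \<open>Restrictions are eliminated from the innermost outwards. Carrying
  \<open>par_free Q\<close> through the induction allows \<open>par_free_restrict_elim\<close> to be
  applied again at each enclosing restriction.\<close>

lemma par_free_rcong_unrestricted:
  assumes "par_free P"
  shows "\<exists>Q. unrestricted Q \<and> par_free Q \<and> P \<equiv>\<^sub>r Q"
  using assms
proof (induction P)
  case Zero
  show ?case by (intro exI[of _ Zero]) auto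
next
  case END
  show ?case by (intro exI[of _ END]) auto
next
  case (Prefix \<alpha> P)
  then obtain Q where "unrestricted Q" "par_free Q" "P \<equiv>\<^sub>r Q" by auto
  then show ?case
    by (intro exI[of _ "Prefix \<alpha> Q"]) (auto intro: rcong.cong_prefix)
next
  case (Seq P1 P2)
  then obtain Q1 Q2 where "unrestricted Q1" "par_free Q1" "P1 \<equiv>\<^sub>r Q1"
    "unrestricted Q2" "par_free Q2" "P2 \<equiv>\<^sub>r Q2" by auto
  then show ?case
    by (intro exI[of _ "Seq Q1 Q2"]) (auto intro: rcong.cong_seq)
next
  case (Choice P1 P2)
  then obtain Q1 Q2 where "unrestricted Q1" "par_free Q1" "P1 \<equiv>\<^sub>r Q1"
    "unrestricted Q2" "par_free Q2" "P2 \<equiv>\<^sub>r Q2" by auto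
  then show ?case
    by (intro exI[of _ "Choice Q1 Q2"]) (auto intro: rcong.cong_choice)
next
  case (Star P)
  then obtain Q where "unrestricted Q" "par_free Q" "P \<equiv>\<^sub>r Q" by auto
  then show ?case
    by (intro exI[of _ "Star Q"]) (auto intro: rcong.cong_star)
next
  case (Restrict P L)
  then obtain Q where "unrestricted Q" "par_free Q" "P \<equiv>\<^sub>r Q" by auto
  with par_free_restrict_elim[of Q L] show ?case
    by (blast intro: rcong.trans rcong.cong_restrict)
qed auto

theorem theorem5p9:
  "(\<forall>P :: 'n :: {countable, infinite} xccs. \<exists>Q. r_external Q \<and> P \<equiv>\<^sub>r Q) \<and>
   (\<forall>P :: 'n xccs. par_free P \<longrightarrow> (\<exists>Q. unrestricted Q \<and> P \<equiv>\<^sub>r Q))"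
proof (intro conjI allI impI)
  show "\<exists>Q. r_external Q \<and> P \<equiv>\<^sub>r Q" for P :: "'n xccs"
    using has_external_form[of P] by (auto simp: has_external_form_def r_external_def)
  show "\<exists>Q. unrestricted Q \<and> P \<equiv>\<^sub>r Q" if "par_free P" for P :: "'n xccs"
    using par_free_rcong_unrestricted[OF that] by blast
qed

end
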